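(* For every integer $k \geq 1$, \[ \frac{2k+3}{8k^2+12k+4} < \left| \frac{\pi}{4} - GLS_k \right| < \frac{1}{4k}. \]
   Context: For an integer $k \geq 1$, $GLS_k$ denotes the $k$th partial sum of the Gregory-Leibniz series, $GLS_k := \sum_{i=1}^{k} (-1)^{i+1} \frac{1}{2i-1}$. *)

theory Defs
  imports Complex_Main
begin

definition GLS :: "nat \<Rightarrow> real" where
  "GLS k = (\<Sum>i=1..k. (-1) ^ (i + 1) * (1 / (2 * real i - 1)))"

end

theory Submission
  imports Defs
begin

text \<open>
  The signed error \<open>E k = (-1)^k (pi/4 - GLS k)\<close> tends to \<open>0\<close> and satisfies
  \<open>E k + E (k + 1) = 1/(2k + 1)\<close>. Hence \<open>E k - E (k + 2) = 2/((2k + 1)(2k + 3))\<close>, which is positive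
  and smaller than \<open>1/(4k) - 1/(4(k + 2)) = 2/(4k^2 + 8k)\<close>. So both \<open>E k\<close> and \<open>1/(4k) - E k\<close>
  decrease in steps of two towards their limit \<open>0\<close> and are therefore positive. The lower bound is
  the upper bound at \<open>k + 1\<close>, since \<open>(2k + 3)/(8k^2 + 12k + 4) = 1/(2k + 1) - 1/(4(k + 1))\<close>.
\<close>

lemma pos_if_step2_decreasing_to_zero:
  fixes f :: "nat \<Rightarrow> real"
  assumes step: "\<And>m. m \<ge> n \<Longrightarrow> f (m + 2) < f m"
    and lim: "f \<longlonglongrightarrow> 0"
  shows "f n > 0"
proof -
  define g where "g m = f (n + 2 * m)" for m
  have "g (Suc m) < g m" for m
    using step[of "n + 2 * m"] by (simp add: g_def add.assoc)
  then have "decseq g"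
    by (intro decseq_SucI less_imp_le)
  moreover have "strict_mono (\<lambda>m. n + 2 * m)"
    by (simp add: strict_mono_def)
  then have "g \<longlonglongrightarrow> 0"
    using LIMSEQ_subseq_LIMSEQ[OF lim, of "\<lambda>m. n + 2 * m"] by (simp add: g_def[abs_def] comp_def)
  \<comment> \<open>The limit bounds a decreasing sequence only weakly. Using \<open>g 1\<close>
    instead of \<open>g 0\<close> leaves one strict step up to \<open>f n\<close>, which makes the
    conclusion strict.\<close>
  ultimately have "g 1 \<ge> 0"
    by (rule decseq_ge)
  moreover have "g 1 < f n"
    using step[of n] by (simp add: g_def)
  ultimately show ?thesis
    by simp
qed

lemma GLS_Suc: "GLS (Suc k) = GLS k + (-1) ^ k / (2 * real k + 1)"
  by (simp add: GLS_def add.commute)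

text \<open>Shifting the index to start at 0 gives the arctangent series at 1, the form in which
  \<open>pi_series\<close> evaluates it.\<close>

lemma GLS_eq_sum: "GLS k = (\<Sum>i<k. (-1) ^ i * (1 / real (i * 2 + 1)))"
proof (induction k)
  case 0
  show ?case by (simp add: GLS_def)
next
  case (Suc k)
  then show ?case by (simp add: GLS_Suc mult.commute)
qed

lemma GLS_tendsto: "GLS \<longlonglongrightarrow> pi / 4"
proof -
  have "summable (\<lambda>i. (-1) ^ i * (1 / real (i * 2 + 1)))"
    using summable_arctan_series[of 1] by simp
  then have "(\<lambda>i. (-1) ^ i * (1 / real (i * 2 + 1))) sums (pi / 4)"
    unfolding sums_iff using pi_series by simp
  then show ?thesis
    unfolding sums_def GLS_eq_sum[symmetric] .
qed

definition gls_error :: "nat \<Rightarrow> real" where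
  "gls_error k = (-1) ^ k * (pi / 4 - GLS k)"

text \<open>The sign factors at \<open>k\<close> and \<open>Suc k\<close> are opposite, so
  \<open>pi / 4\<close> cancels and only the term added between the two partial sums
  survives.\<close>

lemma gls_error_Suc: "gls_error k + gls_error (Suc k) = 1 / (2 * real k + 1)"
proof -
  have "(-1) ^ k * (-1) ^ k = (1 :: real)"
    by (simp flip: power_mult_distrib)
  then show ?thesis
    by (simp add: gls_error_def GLS_Suc algebra_simps)
qed

lemma gls_error_step2:
  "gls_error k - gls_error (k + 2) = 2 / ((2 * real k + 1) * (2 * real k + 3))"
proof -
  have "gls_error k - gls_error (k + 2) = 1 / (2 * real k + 1) - 1 / (2 * real k + 3)"
    using gls_error_Suc[of k] gls_error_Suc[of "Suc k"] by (simp add: algebra_simps)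
  also have "\<dots> = 2 / ((2 * real k + 1) * (2 * real k + 3))"
    by (simp add: divide_simps add_pos_nonneg add_nonneg_eq_0_iff)
  finally show ?thesis .
qed

lemma abs_gls_error: "\<bar>gls_error k\<bar> = \<bar>pi / 4 - GLS k\<bar>"
  by (simp add: gls_error_def abs_mult power_abs)

lemma gls_error_tendsto: "gls_error \<longlonglongrightarrow> 0"
proof (rule tendsto_rabs_zero_cancel)
  show "(\<lambda>k. \<bar>gls_error k\<bar>) \<longlonglongrightarrow> 0"
    unfolding abs_gls_error
    using tendsto_rabs[OF tendsto_diff[OF tendsto_const GLS_tendsto, of "pi / 4"]] by simp
qed

lemma gls_error_pos: "gls_error k > 0"
proof (rule pos_if_step2_decreasing_to_zero[OF _ gls_error_tendsto])
  fix m :: nat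
  have "2 / ((2 * real m + 1) * (2 * real m + 3)) > 0"
    by (intro divide_pos_pos mult_pos_pos) auto
  then show "gls_error (m + 2) < gls_error m"
    using gls_error_step2[of m] by linarith
qed

lemma gls_error_less:
  assumes "k \<ge> 1"
  shows "gls_error k < 1 / (4 * real k)"
proof -
  have "1 / (4 * real k) - gls_error k > 0"
  proof (rule pos_if_step2_decreasing_to_zero[where f = "\<lambda>k. 1 / (4 * real k) - gls_error k"])
    fix m :: nat
    assume "m \<ge> k"
    then have m: "real m > 0"
      using assms by simp
    \<comment> \<open>The left denominator is \<open>4 * m^2 + 8 * m + 3\<close>, which exceeds the
      right one by 3. The right one is chosen so that its fraction splits into the telescoping
      difference below.\<close>
    have "2 / ((2 * real m + 1) * (2 * real m + 3)) < 2 / (4 * real m * (real m + 2))"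
      using m by (intro divide_strict_left_mono mult_pos_pos) (auto simp: algebra_simps)
    also have "\<dots> = 1 / (4 * real m) - 1 / (4 * real (m + 2))"
      using m by (simp add: divide_simps)
    finally show "1 / (4 * real (m + 2)) - gls_error (m + 2) < 1 / (4 * real m) - gls_error m"
      using gls_error_step2[of m] by linarith
  next
    have "(\<lambda>k. 1 / 4 * inverse (real k)) \<longlonglongrightarrow> 1 / 4 * 0"
      by (intro tendsto_intros lim_inverse_n)
    then have "(\<lambda>k. 1 / (4 * real k)) \<longlonglongrightarrow> 0"
      by (simp add: field_simps)
    then show "(\<lambda>k. 1 / (4 * real k) - gls_error k) \<longlonglongrightarrow> 0"
      using tendsto_diff[OF _ gls_error_tendsto] by fastforce
  qed
  then show ?thesis
    by simp
qed

theorem proposition1: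
  fixes k :: nat
  assumes "k \<ge> 1"
  shows "(2 * real k + 3) / (8 * real k ^ 2 + 12 * real k + 4) < \<bar>pi / 4 - GLS k\<bar> \<and>
         \<bar>pi / 4 - GLS k\<bar> < 1 / (4 * real k)"
proof -
  \<comment> \<open>Positivity of the signed error removes the absolute value, so both bounds become
    bounds on \<open>gls_error k\<close>.\<close>
  have abs: "\<bar>pi / 4 - GLS k\<bar> = gls_error k"
    using gls_error_pos[of k] abs_gls_error[of k] by simp
  have "8 * real k ^ 2 + 12 * real k + 4 = (2 * real k + 1) * (4 * (real k + 1))"
    by (simp add: algebra_simps power2_eq_square)
  then have "(2 * real k + 3) / (8 * real k ^ 2 + 12 * real k + 4)
      = (2 * real k + 3) / ((2 * real k + 1) * (4 * (real k + 1)))"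
    by simp
  also have "\<dots> = 1 / (2 * real k + 1) - 1 / (4 * real (Suc k))"
    by (simp add: divide_simps)
  also have "\<dots> < gls_error k"
    using gls_error_Suc[of k] gls_error_less[of "Suc k"] by simp
  finally show ?thesis
    using gls_error_less[OF assms] abs by simp
qed

end
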